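(* Let $p(k)=324k^4 -216k^3 +84k^2 -16k-1$, $q(k)=324k^4 +216 k^3 +84k^2 +16k -1$, and $r(k)=324k^4 +648k^3 +516k^2 +192k +26$. For each integer $n \geq 4$, put $f(n)=\left[ \left(\sum_{k=n}^{\infty}\frac{1}{k^5} \right)^{-1} \right]$. Then \begin{equation*} f(n)=\begin{cases} p(m), & \text{if } n=3m; \\ q(m), & \text{if } n=3m+1; \\ r(m), & \text{if } n=3m+2, \end{cases} \end{equation*} where $m$ is an integer.
   Context: For a real number $x$, $[x]$ denotes the greatest integer less than or equal to $x$. *)

theory Defs
  imports "HOL-Analysis.Analysis"
begin

definition p_poly :: "int \<Rightarrow> int" where
  "p_poly k = 324 * k ^ 4 - 216 * k ^ 3 + 84 * k ^ 2 - 16 * k - 1"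

definition q_poly :: "int \<Rightarrow> int" where
  "q_poly k = 324 * k ^ 4 + 216 * k ^ 3 + 84 * k ^ 2 + 16 * k - 1"

definition r_poly :: "int \<Rightarrow> int" where
  "r_poly k = 324 * k ^ 4 + 648 * k ^ 3 + 516 * k ^ 2 + 192 * k + 26"

text \<open>The tail series starting at \<open>n\<close> is written with its index shifted to start at \<open>0\<close>.\<close>

definition f_tail :: "nat \<Rightarrow> int" where
  "f_tail n = \<lfloor>inverse (\<Sum>k. 1 / real (n + k) ^ 5)\<rfloor>"

end

theory Submission
  imports Defs
begin

text \<open>
  Put \<open>P x = 4 x\<^sup>4 - 8 x\<^sup>3 + (28/3) x\<^sup>2 - (16/3) x\<close>. Since
  \<open>(P (x + 1) - P x) x\<^sup>5 = 16 x\<^sup>8 + (32/3) x\<^sup>6\<close> agrees with \<open>P x * P (x + 1)\<close> up to terms of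
  degree 4, the terms \<open>1 / x\<^sup>5\<close> lie between the telescoping differences of \<open>1 / P\<close> and of
  \<open>1 / (P - 2/3)\<close>. Hence the reciprocal of the tail lies in \<open>[P n - 2/3, P n)\<close>, on which
  the floor is constant because \<open>P n\<close> is an integer if \<open>n\<close> is 0 or 1 modulo 3, and an integer plus
  \<open>2/3\<close> otherwise.
\<close>

text \<open>In terms of \<open>x\<^sup>2 - x\<close> the shift is a reflection:
  \<open>P (x + 1) = P (- x)\<close>. This makes \<open>P (x + 1) - P x\<close> odd in
  \<open>x\<close> and \<open>(P x - c) * (P (x + 1) - c)\<close> even.\<close>

definition P :: "real \<Rightarrow> real" where
  "P x = 4 * (x\<^sup>2 - x)\<^sup>2 + 16/3 * (x\<^sup>2 - x)"

lemma P_expand: "P x = 4 * x^4 - 8 * x^3 + 28/3 * x\<^sup>2 - 16/3 * x"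
  by (simp add: P_def field_simps eval_nat_numeral)

lemma P_Suc: "P (x + 1) = 4 * (x\<^sup>2 + x)\<^sup>2 + 16/3 * (x\<^sup>2 + x)"
proof -
  have "(x + 1)\<^sup>2 - (x + 1) = x\<^sup>2 + x"
    by (simp add: algebra_simps power2_eq_square)
  then show ?thesis by (simp only: P_def)
qed

text \<open>A crude bound that gives positive denominators \<open>P x - c\<close> for
  \<open>c < 4\<close> and the divergence of \<open>P\<close>.\<close>

lemma P_ge:
  assumes "x \<ge> 4"
  shows "P x \<ge> x"
proof -
  define u where "u = x\<^sup>2 - x"
  have "u \<ge> x"
    unfolding u_def using assms mult_right_mono[of 2 x x] by (simp add: power2_eq_square)
  then have "x \<le> 16/3 * u" using assms by linarith
  then show ?thesis unfolding P_def u_def[symmetric]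
    by (simp add: add_increasing)
qed

lemma P_diff: "(P (x + 1) - P x) * x^5 = 16 * x^8 + 32/3 * x^6"
  unfolding P_Suc P_def by (simp add: field_simps eval_nat_numeral)

text \<open>The coefficient \<open>16/9 - 8 * c\<close> changes sign at \<open>c = 2/9\<close>; the
  values \<open>c = 0\<close> and \<open>c = 2/3\<close> used below lie on opposite sides.\<close>

lemma P_shift_mult:
  "(P x - c) * (P (x + 1) - c)
     = 16 * x^8 + 32/3 * x^6 + (16/9 - 8 * c) * x^4 - (256/9 + 56/3 * c) * x\<^sup>2 + c\<^sup>2"
  unfolding P_Suc P_def by (simp add: field_simps eval_nat_numeral)

lemma reciprocal_P_diff:
  assumes "x \<ge> 4" "c < 4"
  shows "1 / (P x - c) - 1 / (P (x + 1) - c)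
           = (16 * x^8 + 32/3 * x^6) / x^5 / ((P x - c) * (P (x + 1) - c))"
proof -
  have "P x - c > 0" "P (x + 1) - c > 0"
    using P_ge[of x] P_ge[of "x + 1"] assms by auto
  then show ?thesis
    unfolding P_diff[symmetric] using assms by (simp add: divide_simps)
qed

lemma reciprocal_P_diff_le_iff:
  assumes "x \<ge> 4" "c < 4"
  shows "1 / (P x - c) - 1 / (P (x + 1) - c) \<le> 1 / x^5
           \<longleftrightarrow> 16 * x^8 + 32/3 * x^6 \<le> (P x - c) * (P (x + 1) - c)"
    and "1 / x^5 \<le> 1 / (P x - c) - 1 / (P (x + 1) - c)
           \<longleftrightarrow> (P x - c) * (P (x + 1) - c) \<le> 16 * x^8 + 32/3 * x^6"
proof -
  have "(P x - c) * (P (x + 1) - c) > 0"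
    using P_ge[of x] P_ge[of "x + 1"] assms by (intro mult_pos_pos) auto
  moreover have "x^5 > 0" using assms by simp
  moreover have "A / y / D \<le> 1 / y \<longleftrightarrow> A \<le> D" "1 / y \<le> A / y / D \<longleftrightarrow> D \<le> A"
    if "y > 0" "D > 0" for A y D :: real
    using that by (simp_all add: field_simps)
  ultimately show
    "1 / (P x - c) - 1 / (P (x + 1) - c) \<le> 1 / x^5
       \<longleftrightarrow> 16 * x^8 + 32/3 * x^6 \<le> (P x - c) * (P (x + 1) - c)"
    "1 / x^5 \<le> 1 / (P x - c) - 1 / (P (x + 1) - c)
       \<longleftrightarrow> (P x - c) * (P (x + 1) - c) \<le> 16 * x^8 + 32/3 * x^6"
    unfolding reciprocal_P_diff[OF assms] by blast+
qed

lemma reciprocal_P_diff_le: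
  assumes "x \<ge> 4"
  shows "1 / P x - 1 / P (x + 1) \<le> 1 / x^5"
proof -
  \<comment> \<open>This is the remainder in \<open>P_shift_mult\<close> at \<open>c = 0\<close>;
    its zero at \<open>x = 4\<close> explains the range of \<open>x\<close>.\<close>
  have "0 \<le> 16/9 * x\<^sup>2 * (x\<^sup>2 - 16)"
    using power_mono[of 4 x 2] assms by (intro mult_nonneg_nonneg) auto
  also have "\<dots> = 16/9 * x^4 - 256/9 * x\<^sup>2"
    by (simp add: field_simps eval_nat_numeral)
  finally show ?thesis
    using reciprocal_P_diff_le_iff(1)[OF assms, of 0] P_shift_mult[of x 0] by simp
qed

lemma reciprocal_P_diff_less:
  assumes "x > 4"
  shows "1 / P x - 1 / P (x + 1) < 1 / x^5"
proof -
  have "0 < 16/9 * x\<^sup>2 * (x\<^sup>2 - 16)"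
    using power_strict_mono[of 4 x 2] assms by (intro mult_pos_pos) auto
  also have "\<dots> = 16/9 * x^4 - 256/9 * x\<^sup>2"
    by (simp add: field_simps eval_nat_numeral)
  \<comment> \<open>The strict inequality is the negation of the reverse one, hence part (2) of the
    equivalence.\<close>
  finally show ?thesis
    using reciprocal_P_diff_le_iff(2)[of x 0] P_shift_mult[of x 0] assms by auto
qed

lemma reciprocal_P_diff_ge:
  assumes "x \<ge> 4"
  shows "1 / x^5 \<le> 1 / (P x - 2/3) - 1 / (P (x + 1) - 2/3)"
proof -
  have "0 \<le> x^4" "1 \<le> x\<^sup>2"
    using power_mono[of 1 x 2] assms by auto
  \<comment> \<open>Nine times the statement that the remainder at \<open>c = 2/3\<close> is at most
    0.\<close>
  then have "4 - 368 * x\<^sup>2 \<le> 32 * x^4" by linarith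
  then have "(P x - 2/3) * (P (x + 1) - 2/3) \<le> 16 * x^8 + 32/3 * x^6"
    unfolding P_shift_mult power2_eq_square[of "2/3"] by simp
  then show ?thesis
    using reciprocal_P_diff_le_iff(2)[OF assms, of "2/3"] by simp
qed

text \<open>Consecutive terms cancel formally, and the boundary term tends to 0 because
  \<open>P\<close> diverges.\<close>

lemma telescope_reciprocal_P:
  fixes n :: nat and c :: real
  shows "(\<lambda>k. 1 / (P (real (n + k)) - c) - 1 / (P (real (n + k) + 1) - c)) sums (1 / (P n - c))"
proof -
  have "filterlim (\<lambda>k. P (real (n + k))) at_top sequentially"
  proof (rule filterlim_at_top_mono[OF filterlim_real_sequentially])
    show "\<forall>\<^sub>F k in sequentially. real k \<le> P (real (n + k))"
    proof (rule eventually_sequentiallyI)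
      fix k :: nat
      assume "4 \<le> k"
      then show "real k \<le> P (real (n + k))" using P_ge[of "real (n + k)"] by simp
    qed
  qed
  then have "filterlim (\<lambda>k. - c + P (real (n + k))) at_top sequentially"
    by (rule filterlim_tendsto_add_at_top[OF tendsto_const])
  then have "(\<lambda>k. 1 / (P (real (n + k)) - c)) \<longlonglongrightarrow> 0"
    by (intro tendsto_divide_0[OF tendsto_const] filterlim_at_top_imp_at_infinity) simp
  from telescope_sums'[OF this] show ?thesis by (simp add: add_ac)
qed

lemma reciprocal_tail_bounds:
  fixes n :: nat
  assumes "n \<ge> 4"
  shows "P n - 2/3 \<le> inverse (\<Sum>k. 1 / real (n + k) ^ 5)"
    and "inverse (\<Sum>k. 1 / real (n + k) ^ 5) < P n"
proof -
  define a where "a = (\<lambda>k. 1 / real (n + k) ^ 5)"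
  define d where
    "d c k = 1 / (P (real (n + k)) - c) - 1 / (P (real (n + k) + 1) - c)" for c :: real and k :: nat
  have d_sums: "d c sums (1 / (P n - c))" for c
    unfolding d_def by (rule telescope_reciprocal_P)
  have ge4: "real (n + k) \<ge> 4" for k using assms by simp
  have upper: "a k \<le> d (2/3) k" for k
    using reciprocal_P_diff_ge[OF ge4] by (simp add: a_def d_def)
  have lower: "d 0 k \<le> a k" for k
    using reciprocal_P_diff_le[OF ge4] by (simp add: a_def d_def)
  have a_sum: "summable a"
    by (rule summable_comparison_test'[OF sums_summable[OF d_sums[of "2/3"]]])
       (use upper in \<open>simp add: a_def\<close>)
  have P_pos: "P n \<ge> 4" using P_ge[of n] assms by simp
  have "suminf a \<le> suminf (d (2/3))"
    using upper a_sum d_sums by (intro suminf_le) (auto simp: sums_iff)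
  then have le: "suminf a \<le> 1 / (P n - 2/3)"
    using d_sums[of "2/3"] by (simp add: sums_iff)
  \<comment> \<open>For \<open>n = 4\<close> the inequality \<open>d 0 k \<le> a k\<close> is an equality at \<open>k = 0\<close>, so strictness must come
    from \<open>k = 1\<close>.\<close>
  have "0 < (\<Sum>k. a k - d 0 k)"
  proof (rule suminf_pos2)
    show "summable (\<lambda>k. a k - d 0 k)"
      using a_sum d_sums[of 0] by (intro summable_diff) (auto simp: sums_iff)
    show "0 \<le> a k - d 0 k" for k using lower[of k] by simp
    show "0 < a 1 - d 0 1"
      using reciprocal_P_diff_less[of "real (n + 1)"] assms by (simp add: a_def d_def add_ac)
  qed
  also have "\<dots> = suminf a - suminf (d 0)"
    using a_sum d_sums[of 0] by (intro suminf_diff[symmetric]) (auto simp: sums_iff)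
  finally have less: "1 / P n < suminf a"
    using d_sums[of 0] by (simp add: sums_iff)
  have "0 < 1 / P n" using P_pos by simp
  then have pos: "0 < suminf a" using less by linarith
  have "P n - 2/3 \<le> inverse (suminf a)" "inverse (suminf a) < P n"
    using le less pos P_pos by (simp_all add: field_simps)
  then show "P n - 2/3 \<le> inverse (\<Sum>k. 1 / real (n + k) ^ 5)"
    "inverse (\<Sum>k. 1 / real (n + k) ^ 5) < P n"
    by (simp_all only: a_def)
qed

theorem theorem3p4:
  fixes n :: nat and m :: int
  assumes "n \<ge> 4"
  shows "(int n = 3 * m \<longrightarrow> f_tail n = p_poly m) \<and>
         (int n = 3 * m + 1 \<longrightarrow> f_tail n = q_poly m) \<and>
         (int n = 3 * m + 2 \<longrightarrow> f_tail n = r_poly m)"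
proof (intro conjI impI)
  note bounds = reciprocal_tail_bounds[OF assms]
  have floor: "f_tail n = z" if "of_int z \<le> P n - 2/3" "P n \<le> of_int z + 1" for z
    unfolding f_tail_def using bounds that by (intro floor_unique) auto
  {
    assume "int n = 3 * m"
    then have n: "real n = 3 * of_int m"
      by (metis of_int_mult of_int_numeral of_int_of_nat_eq)
    \<comment> \<open>As \<open>P n\<close> is an integer, the strict upper bound puts the floor at
      \<open>P n - 1\<close>.\<close>
    have "P n = of_int (p_poly m) + 1"
      unfolding n P_expand p_poly_def by (simp add: algebra_simps power_mult_distrib)
    then show "f_tail n = p_poly m" by (intro floor) auto
  next
    assume "int n = 3 * m + 1"
    then have n: "real n = 3 * of_int m + 1"
      by (metis of_int_1 of_int_add of_int_mult of_int_numeral of_int_of_nat_eq)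
    have "P n = of_int (q_poly m) + 1"
      unfolding n P_expand q_poly_def by (simp add: algebra_simps eval_nat_numeral)
    then show "f_tail n = q_poly m" by (intro floor) auto
  next
    assume "int n = 3 * m + 2"
    then have n: "real n = 3 * of_int m + 2"
      by (metis of_int_add of_int_mult of_int_numeral of_int_of_nat_eq)
    \<comment> \<open>Here the lower bound \<open>P n - 2/3\<close> is exactly the claimed floor, so
      this residue class allows no shift larger than 2/3.\<close>
    have "P n = of_int (r_poly m) + 2/3"
      unfolding n P_expand r_poly_def by (simp add: field_simps eval_nat_numeral)
    then show "f_tail n = r_poly m" by (intro floor) auto
  }
qed

end
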